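(* Let $p$ be a prime, let $M=\mathbb{Z}_{p^\infty}$ be the Prüfer $p$-group, and let $A=\mathbb{Z}\ltimes M$ be the trivial extension of $\mathbb{Z}$ by $M$, with multiplication $(a,x)(b,y)=(ab,\,ay+bx)$. Let $C_p$ denote the unique subgroup of $M$ of order $p$. Then $\operatorname{CoSp}(A)=\{C_p,\,M\}$, where a subgroup $N$ of $M$ is identified with the ideal $0\oplus N$ of $A$.
   Context: All rings are commutative with identity. For ideals $I,J$ of a ring $A$, $\operatorname{Ann}(I)=\{a\in A\mid aI=0\}$ and $(J:I)=\{a\in A\mid aI\subseteq J\}$. The coproduct of $I$ and $J$ is the ideal $[I:J]:=(J:\operatorname{Ann}(I))=\{a\in A\mid a\operatorname{Ann}(I)\subseteq J\}$. An ideal $C$ of $A$ is coprime if $C\neq 0$ and, for all ideals $I,J$ of $A$, $C\subseteq [I:J]$ implies $C\subseteq I$ or $C\subseteq J$. $\operatorname{CoSp}(A)$ is the set of coprime ideals of $A$. The trivial extension $R\ltimes M$ of a commutative ring $R$ by an $R$-module $M$ is the commutative ring with underlying additive group $R\oplus M$, multiplication $(r,m)(s,n)=(rs,rn+sm)$, and identity $(1,0)$. The Prüfer $p$-group $\mathbb{Z}_{p^\infty}$ is the subgroup of $\mathbb{Q}/\mathbb{Z}$ consisting of all elements whose order is a power of $p$. *)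

theory Defs
  imports "HOL-Algebra.IntRing" "HOL-Algebra.Module" "HOL-Algebra.Multiplicative_Group"
begin

subsection \<open>Coprime ideals\<close>

definition annihilator :: "('a, 'b) ring_scheme \<Rightarrow> 'a set \<Rightarrow> 'a set"
  where "annihilator A I = {a \<in> carrier A. \<forall>x\<in>I. a \<otimes>\<^bsub>A\<^esub> x = \<zero>\<^bsub>A\<^esub>}"

text \<open>\<open>ideal_residual A J I\<close> is the colon ideal \<open>(J : I)\<close>; \<open>I\<close> may be any subset of the ring.\<close>

definition ideal_residual :: "('a, 'b) ring_scheme \<Rightarrow> 'a set \<Rightarrow> 'a set \<Rightarrow> 'a set"
  where "ideal_residual A J I = {a \<in> carrier A. \<forall>x\<in>I. a \<otimes>\<^bsub>A\<^esub> x \<in> J}"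

definition ideal_coproduct :: "('a, 'b) ring_scheme \<Rightarrow> 'a set \<Rightarrow> 'a set \<Rightarrow> 'a set"
  where "ideal_coproduct A I J = ideal_residual A J (annihilator A I)"

definition coprime_ideal :: "'a set \<Rightarrow> ('a, 'b) ring_scheme \<Rightarrow> bool"
  where "coprime_ideal C A \<longleftrightarrow>
    ideal C A \<and> C \<noteq> {\<zero>\<^bsub>A\<^esub>} \<and>
    (\<forall>I J. ideal I A \<longrightarrow> ideal J A \<longrightarrow> C \<subseteq> ideal_coproduct A I J \<longrightarrow> C \<subseteq> I \<or> C \<subseteq> J)"

definition CoSp :: "('a, 'b) ring_scheme \<Rightarrow> 'a set set"
  where "CoSp A = {C. coprime_ideal C A}"


subsection \<open>Trivial extensions\<close>

definition trivial_extension ::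
  "('a, 'c) ring_scheme \<Rightarrow> ('a, 'b, 'd) module_scheme \<Rightarrow> ('a \<times> 'b) ring"
  where "trivial_extension R M =
    \<lparr>carrier = carrier R \<times> carrier M,
     mult = (\<lambda>(r, m) (s, n). (r \<otimes>\<^bsub>R\<^esub> s, r \<odot>\<^bsub>M\<^esub> n \<oplus>\<^bsub>M\<^esub> s \<odot>\<^bsub>M\<^esub> m)),
     one = (\<one>\<^bsub>R\<^esub>, \<zero>\<^bsub>M\<^esub>),
     zero = (\<zero>\<^bsub>R\<^esub>, \<zero>\<^bsub>M\<^esub>),
     add = (\<lambda>(r, m) (s, n). (r \<oplus>\<^bsub>R\<^esub> s, m \<oplus>\<^bsub>M\<^esub> n))\<rparr>"

lemma trivial_extension_cring:
  assumes "module R M"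
  shows "cring (trivial_extension R M)"
proof -
  interpret module R M by fact
  show ?thesis
  proof (rule cringI)
    show "abelian_group (trivial_extension R M)"
    proof (rule abelian_groupI)
      fix x assume "x \<in> carrier (trivial_extension R M)"
      then show "\<exists>y\<in>carrier (trivial_extension R M).
          y \<oplus>\<^bsub>trivial_extension R M\<^esub> x = \<zero>\<^bsub>trivial_extension R M\<^esub>"
        by (intro bexI[of _ "(\<ominus>\<^bsub>R\<^esub> fst x, \<ominus>\<^bsub>M\<^esub> snd x)"])
           (auto simp: trivial_extension_def R.l_neg M.l_neg)
    qed (auto simp: trivial_extension_def R.a_ac M.a_ac)
    show "comm_monoid (trivial_extension R M)"
      by (rule comm_monoidI)
         (auto simp: trivial_extension_def R.m_ac M.a_ac smult_r_distr smult_assoc1 [symmetric])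
  qed (auto simp: trivial_extension_def R.l_distr smult_l_distr smult_r_distr M.a_ac)
qed


subsection \<open>Abelian groups as modules over the integers\<close>

text \<open>Groups are written multiplicatively, so \<open>n \<odot> x\<close> is the integer power \<open>x [^] n\<close>.
  The fields \<open>mult\<close> and \<open>one\<close>, which the module record inherits from rings, play no role.\<close>

definition int_module :: "('a, 'b) monoid_scheme \<Rightarrow> (int, 'a) module"
  where "int_module G =
    \<lparr>carrier = carrier G, mult = undefined, one = undefined,
     zero = \<one>\<^bsub>G\<^esub>, add = (\<otimes>\<^bsub>G\<^esub>), smult = (\<lambda>n x. x [^]\<^bsub>G\<^esub> n)\<rparr>"

lemma module_int_module:
  assumes "comm_group G"
  shows "module \<Z> (int_module G)"
proof -
  interpret comm_group G by fact
  show ?thesis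
  proof (rule moduleI)
    show "abelian_group (int_module G)"
      by (rule abelian_groupI) (auto simp: int_module_def m_ac intro: l_inv_ex)
  qed (auto simp: int_module_def int_is_cring int_pow_mult int_pow_distrib int_pow_pow mult.commute)
qed


subsection \<open>The Pruefer group\<close>

definition rat_group :: "rat monoid"
  where "rat_group = \<lparr>carrier = UNIV, mult = (+), one = 0\<rparr>"

definition rat_mod_int :: "rat set monoid"
  where "rat_mod_int = rat_group Mod \<int>"

definition prufer_group :: "nat \<Rightarrow> rat set monoid"
  where "prufer_group p =
    rat_mod_int\<lparr>carrier := {x \<in> carrier rat_mod_int. \<exists>k. group.ord rat_mod_int x = p ^ k}\<rparr>"

text \<open>The description is justified by \<open>prufer_group_ex1_subgroup\<close> below.\<close>

definition prufer_subgroup :: "nat \<Rightarrow> rat set set"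
  where "prufer_subgroup p = (THE H. subgroup H (prufer_group p) \<and> card H = p)"

lemma comm_group_rat_group: "comm_group rat_group"
  by (rule comm_groupI) (auto simp: rat_group_def intro: exI[of _ "- _"] left_minus)

lemma subgroup_Ints_rat_group: "subgroup \<int> rat_group"
proof -
  interpret comm_group rat_group by (rule comm_group_rat_group)
  have "inv\<^bsub>rat_group\<^esub> x = - x" for x
    by (rule inv_equality) (auto simp: rat_group_def)
  then show ?thesis
    by (intro subgroupI) (auto simp: rat_group_def)
qed

lemma comm_group_rat_mod_int: "comm_group rat_mod_int"
  unfolding rat_mod_int_def
  by (rule comm_group.abelian_FactGroup[OF comm_group_rat_group subgroup_Ints_rat_group])

definition rat_coset :: "rat \<Rightarrow> rat set"
  where "rat_coset q = \<int> #>\<^bsub>rat_group\<^esub> q"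

lemma carrier_rat_mod_int: "carrier rat_mod_int = range rat_coset"
  by (auto simp: rat_mod_int_def carrier_FactGroup rat_coset_def rat_group_def)

lemma one_rat_mod_int: "\<one>\<^bsub>rat_mod_int\<^esub> = \<int>"
  by (simp add: rat_mod_int_def)

lemma rat_coset_eq_iff: "rat_coset q = rat_coset r \<longleftrightarrow> q - r \<in> \<int>"
proof -
  have eq: "rat_coset q = {x. x - q \<in> \<int>}" for q
    by (force simp: rat_coset_def r_coset_def rat_group_def)
  show ?thesis
  proof
    assume "rat_coset q = rat_coset r"
    moreover have "q \<in> rat_coset q" by (simp add: eq)
    ultimately show "q - r \<in> \<int>" by (simp add: eq)
  next
    assume qr: "q - r \<in> \<int>"
    have "x - q \<in> \<int> \<longleftrightarrow> x - r \<in> \<int>" for x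
      using Ints_add[OF _ qr, of "x - q"] Ints_diff[OF _ qr, of "x - r"] by auto
    then show "rat_coset q = rat_coset r" by (simp add: eq)
  qed
qed

lemma rat_coset_0: "rat_coset 0 = \<int>"
  by (auto simp: rat_coset_def r_coset_def rat_group_def)

lemma rat_coset_eq_one_iff: "rat_coset q = \<one>\<^bsub>rat_mod_int\<^esub> \<longleftrightarrow> q \<in> \<int>"
  using rat_coset_eq_iff[of q 0] by (simp add: rat_coset_0 one_rat_mod_int)

lemma rat_coset_mult: "rat_coset q \<otimes>\<^bsub>rat_mod_int\<^esub> rat_coset r = rat_coset (q + r)"
proof -
  interpret comm_group rat_group by (rule comm_group_rat_group)
  interpret normal \<int> rat_group
    using normal_iff_subgroup subgroup_Ints_rat_group by blast
  show ?thesis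
    using rcos_sum[of q r] by (simp add: rat_mod_int_def rat_coset_def rat_group_def)
qed

lemma rat_coset_pow: "rat_coset q [^]\<^bsub>rat_mod_int\<^esub> (n :: nat) = rat_coset (of_nat n * q)"
proof -
  interpret comm_group rat_mod_int by (rule comm_group_rat_mod_int)
  show ?thesis
    by (induction n)
       (auto simp: one_rat_mod_int rat_coset_0 rat_coset_mult algebra_simps)
qed

lemma subgroup_prufer_group:
  assumes "prime p"
  shows "subgroup (carrier (prufer_group p)) rat_mod_int"
proof -
  interpret comm_group rat_mod_int by (rule comm_group_rat_mod_int)
  have iff: "x \<in> carrier (prufer_group p) \<longleftrightarrow>
      x \<in> carrier rat_mod_int \<and> (\<exists>k. x [^]\<^bsub>rat_mod_int\<^esub> (p ^ k :: nat) = \<one>\<^bsub>rat_mod_int\<^esub>)" for x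
    using divides_primepow_nat[OF assms] pow_eq_id[of x]
    by (auto simp: prufer_group_def) blast
  show ?thesis
  proof (rule subgroupI)
    show "carrier (prufer_group p) \<noteq> {}"
      using iff[of "\<one>\<^bsub>rat_mod_int\<^esub>"] by auto
  next
    fix x y assume x: "x \<in> carrier (prufer_group p)" and y: "y \<in> carrier (prufer_group p)"
    obtain j k where
      j: "x \<in> carrier rat_mod_int" "x [^]\<^bsub>rat_mod_int\<^esub> (p ^ j :: nat) = \<one>\<^bsub>rat_mod_int\<^esub>" and
      k: "y \<in> carrier rat_mod_int" "y [^]\<^bsub>rat_mod_int\<^esub> (p ^ k :: nat) = \<one>\<^bsub>rat_mod_int\<^esub>"
      using x y iff by blast
    have "x [^]\<^bsub>rat_mod_int\<^esub> (p ^ (j + k) :: nat) = \<one>\<^bsub>rat_mod_int\<^esub>"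
      using j by (simp add: power_add flip: nat_pow_pow)
    moreover have "y [^]\<^bsub>rat_mod_int\<^esub> (p ^ (j + k) :: nat) = \<one>\<^bsub>rat_mod_int\<^esub>"
      using k by (simp add: power_add mult.commute[of "p ^ j"] flip: nat_pow_pow)
    ultimately have "(x \<otimes>\<^bsub>rat_mod_int\<^esub> y) [^]\<^bsub>rat_mod_int\<^esub> (p ^ (j + k) :: nat) = \<one>\<^bsub>rat_mod_int\<^esub>"
      using j k by (simp add: nat_pow_distrib)
    then show "x \<otimes>\<^bsub>rat_mod_int\<^esub> y \<in> carrier (prufer_group p)"
      using iff j(1) k(1) by blast
    show "inv\<^bsub>rat_mod_int\<^esub> x \<in> carrier (prufer_group p)"
      using iff j by (metis inv_closed inv_one nat_pow_inv)
  qed (use iff in auto)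
qed

lemma comm_group_prufer_group:
  assumes "prime p"
  shows "comm_group (prufer_group p)"
proof -
  interpret comm_group rat_mod_int by (rule comm_group_rat_mod_int)
  have "prufer_group p = rat_mod_int\<lparr>carrier := carrier (prufer_group p)\<rparr>"
    by (simp add: prufer_group_def)
  moreover have "group (rat_mod_int\<lparr>carrier := carrier (prufer_group p)\<rparr>)"
    using subgroup_imp_group subgroup_prufer_group[OF assms] by blast
  ultimately have "group (prufer_group p)" by simp
  then show ?thesis
    by (rule group.group_comm_groupI) (auto simp: prufer_group_def m_comm)
qed

lemma prufer_group_ex1_subgroup:
  assumes "prime p"
  shows "\<exists>!H. subgroup H (prufer_group p) \<and> card H = p"
proof -
  interpret Q: comm_group rat_mod_int by (rule comm_group_rat_mod_int)
  interpret P: comm_group "prufer_group p" by (rule comm_group_prufer_group[OF assms])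
  have p: "p > 0" using assms prime_gt_0_nat by blast
  have pow: "x [^]\<^bsub>prufer_group p\<^esub> (n :: nat) = x [^]\<^bsub>rat_mod_int\<^esub> n" for x n
    by (simp add: prufer_group_def nat_pow_def)
  have one: "\<one>\<^bsub>prufer_group p\<^esub> = \<one>\<^bsub>rat_mod_int\<^esub>"
    and mult: "x \<otimes>\<^bsub>prufer_group p\<^esub> y = x \<otimes>\<^bsub>rat_mod_int\<^esub> y" for x y
    by (simp_all add: prufer_group_def)
  have car: "carrier (prufer_group p) \<subseteq> carrier rat_mod_int"
    by (auto simp: prufer_group_def)
  define T where "T = {x \<in> carrier rat_mod_int. x [^]\<^bsub>rat_mod_int\<^esub> p = \<one>\<^bsub>rat_mod_int\<^esub>}"
  have "T = (\<lambda>k. rat_coset (of_nat k / of_nat p)) ` {..<p}"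
  proof (intro equalityI subsetI)
    fix x assume "x \<in> T"
    then obtain q where q: "x = rat_coset q" "of_nat p * q \<in> \<int>"
      by (auto simp: T_def carrier_rat_mod_int rat_coset_pow rat_coset_eq_one_iff)
    then obtain n where n: "of_nat p * q = of_int n" by (auto elim: Ints_cases)
    define k where "k = nat (n mod int p)"
    have k: "k < p" "int k = n mod int p" using p by (auto simp: k_def nat_less_iff)
    have "n = int p * (n div int p) + int k" using k by simp
    then have "of_nat p * q = of_nat p * of_int (n div int p) + of_nat k"
      unfolding n by (metis of_int_add of_int_mult of_int_of_nat_eq)
    then have "q - of_nat k / of_nat p = of_int (n div int p)"
      using p by (simp add: field_simps)
    then have "x = rat_coset (of_nat k / of_nat p)"
      using q by (simp add: rat_coset_eq_iff)
    with k show "x \<in> (\<lambda>k. rat_coset (of_nat k / of_nat p)) ` {..<p}" by blast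
  next
    fix x assume "x \<in> (\<lambda>k. rat_coset (of_nat k / of_nat p)) ` {..<p}"
    then obtain k where "x = rat_coset (of_nat k / of_nat p)" by blast
    then show "x \<in> T"
      using p by (simp add: T_def carrier_rat_mod_int rat_coset_pow rat_coset_eq_one_iff)
  qed
  moreover have "inj_on (\<lambda>k. rat_coset (of_nat k / of_nat p)) {..<p}"
  proof (rule inj_onI)
    fix j k assume jk: "j \<in> {..<p}" "k \<in> {..<p}"
      and "rat_coset (of_nat j / of_nat p) = rat_coset (of_nat k / of_nat p)"
    then have "(of_nat j / of_nat p - of_nat k / of_nat p :: rat) \<in> \<int>"
      by (simp add: rat_coset_eq_iff)
    then obtain n where "(of_nat j / of_nat p - of_nat k / of_nat p :: rat) = of_int n"
      by (auto elim: Ints_cases)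
    then have "(of_nat j - of_nat k :: rat) = of_int n * of_nat p"
      using p by (simp add: field_simps)
    then have "(of_int (int j - int k) :: rat) = of_int (n * int p)"
      by simp
    then have "int j - int k = n * int p" by (simp only: of_int_eq_iff)
    then have "int j mod int p = int k mod int p"
      by (metis mod_eq_dvd_iff dvd_triv_right)
    then show "j = k" using jk by simp
  qed
  ultimately have card_T: "card T = p" and fin_T: "finite T"
    by (simp_all add: card_image)
  have T_sub: "T \<subseteq> carrier (prufer_group p)"
  proof
    fix x assume "x \<in> T"
    then have "x \<in> carrier rat_mod_int" "group.ord rat_mod_int x dvd p ^ 1"
      by (auto simp: T_def Q.pow_eq_id)
    then show "x \<in> carrier (prufer_group p)"
      using divides_primepow_nat[OF assms, of _ 1] by (auto simp: prufer_group_def)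
  qed
  have "subgroup T (prufer_group p)"
  proof (rule P.subgroupI)
    have "\<one>\<^bsub>rat_mod_int\<^esub> \<in> T" by (simp add: T_def)
    then show "T \<noteq> {}" by blast
    fix x assume x: "x \<in> T"
    then have "inv\<^bsub>prufer_group p\<^esub> x [^]\<^bsub>prufer_group p\<^esub> p = \<one>\<^bsub>prufer_group p\<^esub>"
      using T_sub by (metis (mono_tags, lifting) P.inv_one P.nat_pow_inv T_def mem_Collect_eq one pow subsetD)
    moreover have "inv\<^bsub>prufer_group p\<^esub> x \<in> carrier (prufer_group p)"
      using x T_sub by blast
    ultimately show "inv\<^bsub>prufer_group p\<^esub> x \<in> T"
      using car by (auto simp: T_def pow one)
    fix y assume "y \<in> T"
    with x show "x \<otimes>\<^bsub>prufer_group p\<^esub> y \<in> T"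
      by (simp add: T_def mult Q.nat_pow_distrib)
  qed (rule T_sub)
  moreover have "H = T" if H: "subgroup H (prufer_group p)" "card H = p" for H
  proof -
    interpret H: group "(prufer_group p)\<lparr>carrier := H\<rparr>"
      using H(1) P.subgroup_imp_group by blast
    have "x \<in> T" if x: "x \<in> H" for x
    proof -
      have "x [^]\<^bsub>(prufer_group p)\<lparr>carrier := H\<rparr>\<^esub> card H = \<one>\<^bsub>prufer_group p\<^esub>"
        using H.pow_order_eq_1[of x] x by (simp add: order_def)
      then have "x [^]\<^bsub>rat_mod_int\<^esub> p = \<one>\<^bsub>rat_mod_int\<^esub>"
        by (simp add: H(2) prufer_group_def nat_pow_def)
      with x car subgroup.subset[OF H(1)] show ?thesis by (auto simp: T_def)
    qed
    then show ?thesis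
      using card_subset_eq[OF fin_T, of H] card_T H(2) by auto
  qed
  ultimately show ?thesis using card_T by blast
qed

end

theory Submission
  imports Defs
begin

text \<open>
  Write \<open>M\<close> for the Pruefer group and \<open>C\<close> for its subgroup of order \<open>p\<close>. Of two elements of
  \<open>M\<close>, the one of smaller order is a multiple of the other. Hence \<open>M\<close> is divisible, every
  proper subgroup of \<open>M\<close> is killed by a power of \<open>p\<close>, and \<open>0 \<times> C\<close> is the least nonzero ideal
  of the trivial extension, so it is coprime. If \<open>I\<close> does not contain \<open>0 \<times> M\<close>, then \<open>I = 0 \<times> N\<close>
  for a proper subgroup \<open>N\<close>, so \<open>(p\<^sup>k, 0)\<close> annihilates \<open>I\<close> for some \<open>k\<close>; as \<open>p\<^sup>k M = M\<close>, the ideal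
  \<open>0 \<times> M\<close> is coprime as well. Conversely, since \<open>0 \<times> M\<close> is its own annihilator, testing a
  coprime ideal against \<open>I = J = 0 \<times> M\<close> shows that it is \<open>0 \<times> N\<close> for some \<open>N \<le> M\<close>. Testing
  it against \<open>I = 0 \<times> C\<close> and \<open>J = 0 \<times> pN\<close> gives \<open>N \<subseteq> C\<close> or \<open>N \<subseteq> pN\<close>, and in the second
  case \<open>N\<close> is all of \<open>M\<close>.
\<close>

section \<open>Computation with rational representatives of cosets\<close>

lemma rat_coset_int_pow: "rat_coset q [^]\<^bsub>rat_mod_int\<^esub> (n :: int) = rat_coset (of_int n * q)"
proof -
  interpret comm_group rat_mod_int by (rule comm_group_rat_mod_int)
  have "inv\<^bsub>rat_mod_int\<^esub> rat_coset r = rat_coset (- r)" for r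
    by (rule inv_equality)
       (auto simp: rat_coset_mult one_rat_mod_int rat_coset_0 carrier_rat_mod_int)
  then show ?thesis
    by (cases n rule: int_cases2)
       (simp_all add: int_pow_int int_pow_neg_int rat_coset_pow carrier_rat_mod_int)
qed

text \<open>Negative powers use inverses, which are defined relative to the carrier; they agree in
  both groups because the smaller carrier is a subgroup.\<close>

lemma prufer_group_int_pow:
  assumes "prime p" "x \<in> carrier (prufer_group p)"
  shows "x [^]\<^bsub>prufer_group p\<^esub> (n :: int) = x [^]\<^bsub>rat_mod_int\<^esub> n"
proof -
  interpret comm_group rat_mod_int by (rule comm_group_rat_mod_int)
  have "prufer_group p = rat_mod_int\<lparr>carrier := carrier (prufer_group p)\<rparr>"
    by (simp add: prufer_group_def)
  then show ?thesis
    using int_pow_consistent[OF subgroup_prufer_group[OF assms(1)] assms(2), of n] by simp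
qed

lemma one_prufer_group: "\<one>\<^bsub>prufer_group p\<^esub> = \<one>\<^bsub>rat_mod_int\<^esub>"
  by (simp add: prufer_group_def)

text \<open>The divisors of \<open>p ^ k\<close> are powers of \<open>p\<close>, so having order a
  power of \<open>p\<close> amounts to being killed by one, and that can be read off a
  representative.\<close>

lemma rat_coset_in_prufer_group_iff:
  assumes "prime p"
  shows "rat_coset q \<in> carrier (prufer_group p) \<longleftrightarrow> (\<exists>k. of_nat (p ^ k) * q \<in> \<int>)"
proof -
  interpret comm_group rat_mod_int by (rule comm_group_rat_mod_int)
  have "(\<exists>k. ord (rat_coset q) = p ^ k) \<longleftrightarrow> (\<exists>k. ord (rat_coset q) dvd p ^ k)"
    using divides_primepow_nat[OF assms] by (metis dvd_refl)
  also have "\<dots> \<longleftrightarrow> (\<exists>k. of_nat (p ^ k) * q \<in> \<int>)"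
    by (subst pow_eq_id [symmetric])
       (simp_all add: carrier_rat_mod_int rat_coset_pow rat_coset_eq_one_iff)
  finally show ?thesis
    by (simp add: prufer_group_def carrier_rat_mod_int)
qed

lemma prufer_group_int_pow_rat_coset:
  assumes "prime p" "rat_coset q \<in> carrier (prufer_group p)"
  shows "rat_coset q [^]\<^bsub>prufer_group p\<^esub> (n :: int) = rat_coset (of_int n * q)"
  using assms by (simp add: prufer_group_int_pow rat_coset_int_pow)

lemma prufer_group_carrierE:
  assumes "x \<in> carrier (prufer_group p)"
  obtains q where "x = rat_coset q"
  using assms by (auto simp: prufer_group_def carrier_rat_mod_int)

lemma prufer_group_torsion:
  assumes "prime p" "x \<in> carrier (prufer_group p)"
  shows "\<exists>k. x [^]\<^bsub>prufer_group p\<^esub> int (p ^ k) = \<one>\<^bsub>prufer_group p\<^esub>"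
proof -
  obtain q where q: "x = rat_coset q" using prufer_group_carrierE[OF assms(2)] .
  then obtain k where "of_nat (p ^ k) * q \<in> \<int>"
    using assms rat_coset_in_prufer_group_iff by blast
  then show ?thesis
    using assms q
    by (intro exI[of _ k])
       (simp add: prufer_group_int_pow_rat_coset one_prufer_group rat_coset_eq_one_iff)
qed

text \<open>The witness is the class of \<open>1 / p ^ k\<close>. Its order is given by the trivial
  integer powers because first coordinates of ring elements act as integer exponents.\<close>

lemma prufer_group_elem_of_order:
  assumes "prime p"
  obtains z where "z \<in> carrier (prufer_group p)"
    "\<And>n :: int. z [^]\<^bsub>prufer_group p\<^esub> n = \<one>\<^bsub>prufer_group p\<^esub> \<longleftrightarrow> int (p ^ k) dvd n"
proof
  have p: "p > 0" using assms prime_gt_0_nat by blast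
  let ?q = "1 / of_nat (p ^ k) :: rat"
  show z: "rat_coset ?q \<in> carrier (prufer_group p)"
    unfolding rat_coset_in_prufer_group_iff[OF assms] by (rule exI[of _ k]) (use p in simp)
  fix n :: int
  have "of_int n / of_nat (p ^ k) \<in> (\<int> :: rat set) \<longleftrightarrow> int (p ^ k) dvd n"
  proof
    assume "of_int n / of_nat (p ^ k) \<in> (\<int> :: rat set)"
    then obtain m where "of_int n / of_nat (p ^ k) = (of_int m :: rat)" by (auto elim: Ints_cases)
    then have "(of_int n :: rat) = of_int (m * int (p ^ k))"
      using p by (simp add: field_simps)
    then show "int (p ^ k) dvd n" by (metis of_int_eq_iff dvd_triv_right)
  next
    assume "int (p ^ k) dvd n"
    then show "of_int n / of_nat (p ^ k) \<in> (\<int> :: rat set)"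
      using p by (auto elim!: dvdE)
  qed
  then show "rat_coset ?q [^]\<^bsub>prufer_group p\<^esub> n = \<one>\<^bsub>prufer_group p\<^esub> \<longleftrightarrow> int (p ^ k) dvd n"
    using assms z by (simp add: prufer_group_int_pow_rat_coset one_prufer_group rat_coset_eq_one_iff)
qed

text \<open>This makes the cyclic subgroups of \<open>M\<close> comparable. The order of
  \<open>x\<close> divides \<open>p ^ Suc k\<close>, while that of \<open>y\<close> is a multiple of
  it. With \<open>y\<close> the class of \<open>b / p ^ j\<close> in lowest terms, inverting
  \<open>b\<close> modulo \<open>p ^ j\<close> yields the exponent.\<close>

lemma prufer_group_power_of:
  assumes p: "prime p" and x: "x \<in> carrier (prufer_group p)" and y: "y \<in> carrier (prufer_group p)"
    and xk: "x [^]\<^bsub>prufer_group p\<^esub> int (p ^ Suc k) = \<one>\<^bsub>prufer_group p\<^esub>"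
    and yk: "y [^]\<^bsub>prufer_group p\<^esub> int (p ^ k) \<noteq> \<one>\<^bsub>prufer_group p\<^esub>"
  shows "\<exists>n :: int. x = y [^]\<^bsub>prufer_group p\<^esub> n"
proof -
  have p0: "p > 0" using p prime_gt_0_nat by blast
  obtain q r where q: "x = rat_coset q" and r: "y = rat_coset r"
    using x y prufer_group_carrierE by metis
  have "of_nat (p ^ Suc k) * q \<in> \<int>"
    using xk x p q by (simp add: prufer_group_int_pow_rat_coset one_prufer_group rat_coset_eq_one_iff)
  then obtain a where a: "of_nat (p ^ Suc k) * q = of_int a" by (auto elim: Ints_cases)
  have nk: "of_nat (p ^ k) * r \<notin> \<int>"
    using yk y p r by (simp add: prufer_group_int_pow_rat_coset one_prufer_group rat_coset_eq_one_iff)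
  \<comment> \<open>The order of \<open>y\<close> is \<open>p ^ j\<close>. Minimality of
    \<open>j\<close>, together with \<open>k < j\<close>, makes the numerator \<open>b\<close> below
    prime to \<open>p\<close>.\<close>
  define j where "j = (LEAST j. of_nat (p ^ j) * r \<in> \<int>)"
  have j: "of_nat (p ^ j) * r \<in> \<int>"
    unfolding j_def using y p r rat_coset_in_prufer_group_iff by (metis (mono_tags, lifting) LeastI_ex)
  have jk: "k < j"
  proof (rule ccontr)
    assume "\<not> k < j"
    then have "p ^ k = p ^ (k - j) * p ^ j" by (simp flip: power_add)
    then have "of_nat (p ^ k) * r = of_nat (p ^ (k - j)) * (of_nat (p ^ j) * r)"
      by (metis of_nat_mult mult.assoc)
    with j nk show False by (metis Ints_mult Ints_of_nat)
  qed
  then obtain i where i: "j = Suc k + i" by (metis less_iff_Suc_add add_Suc)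
  obtain b where b: "of_nat (p ^ j) * r = of_int b" using j by (auto elim: Ints_cases)
  have "\<not> int p dvd b"
  proof
    assume "int p dvd b"
    then obtain c where "b = int p * c" by (auto elim: dvdE)
    then have "of_nat (p ^ (k + i)) * r = of_int c" using b p0 i by simp
    then have "of_nat (p ^ (k + i)) * r \<in> \<int>" by simp
    then show False
      using not_less_Least[of "k + i" "\<lambda>j. of_nat (p ^ j) * r \<in> \<int>"] i
      unfolding j_def[symmetric] by simp
  qed
  then have "coprime b (int p ^ j)"
    using p prime_imp_coprime[of "int p" b] by (simp add: coprime_commute)
  then obtain u v where uv: "u * b + v * int p ^ j = 1"
    by (metis bezout_int coprime_imp_gcd_eq_1)
  \<comment> \<open>Over the denominator \<open>p ^ j\<close> the numerators of \<open>q\<close> and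
    \<open>r\<close> are \<open>a * p ^ i\<close> and \<open>b\<close>, so \<open>n * b\<close> has
    to be congruent to \<open>a * p ^ i\<close> modulo \<open>p ^ j\<close>; \<open>u\<close>
    inverts \<open>b\<close> there.\<close>
  define n where "n = a * int p ^ i * u"
  have pk: "of_nat p ^ j = (of_nat p ^ Suc k * of_nat p ^ i :: rat)" by (simp add: i power_add)
  have "of_int u * of_int b + of_int v * of_nat p ^ j = (1 :: rat)"
    using arg_cong[OF uv, of "of_int :: int \<Rightarrow> rat"] by simp
  then have e: "of_int u * of_int b - 1 = - of_int v * (of_nat p ^ j :: rat)"
    by (simp add: algebra_simps)
  have "of_nat p ^ j * (of_int n * r - q) = of_int a * of_nat p ^ i * (of_int u * of_int b - 1)"
    by (simp add: n_def pk algebra_simps flip: a b)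
  also have "\<dots> = of_nat p ^ j * of_int (- a * v * int p ^ i)" by (simp add: e)
  finally have "of_int n * r - q = of_int (- a * v * int p ^ i)"
    using p0 by (subst (asm) mult_left_cancel) simp_all
  then have "of_int n * r - q \<in> \<int>" by (metis Ints_of_int)
  then have "y [^]\<^bsub>prufer_group p\<^esub> n = x"
    using p y q r by (simp add: prufer_group_int_pow_rat_coset rat_coset_eq_iff)
  then show ?thesis by blast
qed

section \<open>Ideals and subgroups in a trivial extension of the integers\<close>

abbreviation idealization :: "('a, 'b) monoid_scheme \<Rightarrow> (int \<times> 'a) ring"
  where "idealization G \<equiv> trivial_extension \<Z> (int_module G)"

lemma idealization_simps:
  "carrier (idealization G) = UNIV \<times> carrier G"
  "\<zero>\<^bsub>idealization G\<^esub> = (0, \<one>\<^bsub>G\<^esub>)"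
  "\<one>\<^bsub>idealization G\<^esub> = (1, \<one>\<^bsub>G\<^esub>)"
  "(a, x) \<oplus>\<^bsub>idealization G\<^esub> (b, y) = (a + b, x \<otimes>\<^bsub>G\<^esub> y)"
  "(a, x) \<otimes>\<^bsub>idealization G\<^esub> (b, y) = (a * b, y [^]\<^bsub>G\<^esub> a \<otimes>\<^bsub>G\<^esub> x [^]\<^bsub>G\<^esub> b)"
  by (simp_all add: trivial_extension_def int_module_def)

context comm_group
begin

lemma cring_idealization: "cring (idealization G)"
  by (rule trivial_extension_cring[OF module_int_module[OF comm_group_axioms]])

text \<open>The product of \<open>(n, x)\<close> and \<open>(0, y)\<close> is
  \<open>(0, y [^] n)\<close>, so the ring acts on the second summand through integer powers, under
  which a subgroup is closed.\<close>

lemma ideal_of_subgroup: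
  assumes "subgroup N G"
  shows "ideal ({0} \<times> N) (idealization G)"
proof -
  interpret E: cring "idealization G" by (rule cring_idealization)
  interpret N: subgroup N G by fact
  note [simp] = idealization_simps
  have neg: "\<ominus>\<^bsub>idealization G\<^esub> (0, x) = (0, inv x)" if "x \<in> N" for x
    using that by (intro E.minus_equality) auto
  have powN: "x [^] (n :: int) \<in> N" if "x \<in> N" for x n
    using subgroup_int_pow_closed[OF assms that] .
  have "subgroup ({0} \<times> N) (add_monoid (idealization G))"
  proof (rule E.add.subgroupI)
    show "{0} \<times> N \<noteq> {}" using N.one_closed by blast
  qed (auto simp: neg simp flip: a_inv_def)
  then show ?thesis
    by (rule idealI[OF E.ring_axioms]) (auto simp: powN)
qed

lemma ideal_snd_carrier:
  assumes "ideal I (idealization G)" "(a, x) \<in> I"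
  shows "x \<in> carrier G"
  using ideal.Icarr[OF assms] by (simp add: idealization_simps)

lemma subgroup_of_ideal:
  assumes "ideal I (idealization G)"
  shows "subgroup {x. (0, x) \<in> I} G"
proof (rule subgroupI)
  interpret I: ideal I "idealization G" by fact
  note [simp] = idealization_simps
  show "{x. (0, x) \<in> I} \<subseteq> carrier G"
    using ideal_snd_carrier[OF assms] by blast
  show "{x. (0, x) \<in> I} \<noteq> {}"
    using additive_subgroup.zero_closed[OF ideal.axioms(1)[OF assms]] by auto
  \<comment> \<open>Inversion is multiplication by the ring element
    \<open>(-1, \<one>)\<close>.\<close>
  show "inv x \<in> {x. (0, x) \<in> I}" if "x \<in> {x. (0, x) \<in> I}" for x
    using I.I_l_closed[of "(0, x)" "(-1, \<one>)"] that ideal_snd_carrier[OF assms, of 0 x]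
    by (simp add: int_pow_neg)
  show "x \<otimes> y \<in> {x. (0, x) \<in> I}" if "x \<in> {x. (0, x) \<in> I}" "y \<in> {x. (0, x) \<in> I}" for x y
    using additive_subgroup.a_closed[OF ideal.axioms(1)[OF assms], of "(0, x)" "(0, y)"] that
    by simp
qed

text \<open>Multiplication by \<open>(0, z)\<close> erases \<open>x\<close>, which is raised to the
  power 0, and leaves only the action of \<open>n\<close> on \<open>z\<close>.\<close>

lemma ideal_pow_closed:
  assumes "ideal I (idealization G)" "(n, x) \<in> I" "z \<in> carrier G"
  shows "(0, z [^] n) \<in> I"
proof -
  interpret I: ideal I "idealization G" by fact
  show ?thesis
    using I.I_l_closed[OF assms(2), of "(0, z)"] assms ideal_snd_carrier[OF assms(1,2)]
    by (simp add: idealization_simps)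
qed

text \<open>Powers are endomorphisms of an abelian group. With exponent \<open>p\<close> this
  supplies the test ideal \<open>0 \<times> pN\<close>.\<close>

lemma subgroup_image_int_pow:
  assumes "subgroup N G"
  shows "subgroup ((\<lambda>x. x [^] (n :: int)) ` N) G"
proof (rule subgroupI)
  interpret N: subgroup N G by fact
  show "(\<lambda>x. x [^] n) ` N \<subseteq> carrier G" by auto
  show "(\<lambda>x. x [^] n) ` N \<noteq> {}" using N.one_closed by blast
  show "inv y \<in> (\<lambda>x. x [^] n) ` N" if "y \<in> (\<lambda>x. x [^] n) ` N" for y
    using that by (auto intro!: image_eqI[where x = "inv _"] simp: int_pow_inv)
  show "y \<otimes> z \<in> (\<lambda>x. x [^] n) ` N"
    if yz: "y \<in> (\<lambda>x. x [^] n) ` N" "z \<in> (\<lambda>x. x [^] n) ` N" for y z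
  proof -
    obtain u v where "u \<in> N" "y = u [^] n" "v \<in> N" "z = v [^] n"
      using yz by blast
    then show ?thesis by (intro image_eqI[of _ _ "u \<otimes> v"]) (auto simp: int_pow_distrib)
  qed
qed

end

section \<open>Subgroups of the Pruefer group\<close>

lemma subgroup_prufer_subgroup:
  assumes "prime p"
  shows "subgroup (prufer_subgroup p) (prufer_group p)"
  using theI'[OF prufer_group_ex1_subgroup[OF assms]] unfolding prufer_subgroup_def by blast

lemma prufer_subgroup_nontrivial:
  assumes "prime p"
  shows "\<exists>y\<in>prufer_subgroup p. y \<noteq> \<one>\<^bsub>prufer_group p\<^esub>"
proof (rule ccontr)
  assume "\<not> ?thesis"
  then have "prufer_subgroup p \<subseteq> {\<one>\<^bsub>prufer_group p\<^esub>}" by blast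
  then have "card (prufer_subgroup p) \<le> card {\<one>\<^bsub>prufer_group p\<^esub>}" by (intro card_mono) auto
  moreover have "card (prufer_subgroup p) = p"
    using theI'[OF prufer_group_ex1_subgroup[OF assms]] unfolding prufer_subgroup_def by blast
  ultimately show False using prime_gt_1_nat[OF assms] by simp
qed

text \<open>Lagrange's theorem gives one inclusion. For the other, any nontrivial \<open>y\<close>
  in the subgroup generates the whole \<open>p\<close>-torsion: this is the comparison of orders at
  \<open>k = 0\<close>.\<close>

lemma prufer_subgroup_eq:
  assumes "prime p"
  shows "prufer_subgroup p =
    {x \<in> carrier (prufer_group p). x [^]\<^bsub>prufer_group p\<^esub> int p = \<one>\<^bsub>prufer_group p\<^esub>}"
    (is "_ = ?T")
proof -
  interpret P: comm_group "prufer_group p" by (rule comm_group_prufer_group[OF assms])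
  let ?H = "prufer_subgroup p"
  have H: "subgroup ?H (prufer_group p)" "card ?H = p"
    using theI'[OF prufer_group_ex1_subgroup[OF assms]] unfolding prufer_subgroup_def by blast+
  interpret H: group "(prufer_group p)\<lparr>carrier := ?H\<rparr>"
    using H(1) P.subgroup_imp_group by blast
  have "?H \<subseteq> ?T"
  proof
    fix x assume x: "x \<in> ?H"
    then have "x [^]\<^bsub>(prufer_group p)\<lparr>carrier := ?H\<rparr>\<^esub> p = \<one>\<^bsub>prufer_group p\<^esub>"
      using H.pow_order_eq_1[of x] H(2) by (simp add: order_def)
    with x subgroup.subset[OF H(1)] show "x \<in> ?T"
      by (auto simp: int_pow_int nat_pow_def)
  qed
  moreover obtain y where y: "y \<in> ?H" "y \<noteq> \<one>\<^bsub>prufer_group p\<^esub>"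
    using prufer_subgroup_nontrivial[OF assms] ..
  have "?T \<subseteq> ?H"
  proof
    fix x assume "x \<in> ?T"
    then obtain n :: int where "x = y [^]\<^bsub>prufer_group p\<^esub> n"
      using prufer_group_power_of[OF assms, of x y 0] y subgroup.subset[OF H(1)] by auto
    then show "x \<in> ?H"
      using P.subgroup_int_pow_closed[OF H(1) y(1)] by simp
  qed
  ultimately show ?thesis by blast
qed

text \<open>Any nontrivial element of \<open>N\<close> already generates the whole
  \<open>p\<close>-torsion.\<close>

lemma prufer_subgroup_least:
  assumes "prime p" "subgroup N (prufer_group p)" "N \<noteq> {\<one>\<^bsub>prufer_group p\<^esub>}"
  shows "prufer_subgroup p \<subseteq> N"
proof
  interpret P: comm_group "prufer_group p" by (rule comm_group_prufer_group[OF assms(1)])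
  fix x assume "x \<in> prufer_subgroup p"
  moreover obtain y where y: "y \<in> N" "y \<noteq> \<one>\<^bsub>prufer_group p\<^esub>"
    using assms(3) subgroup.one_closed[OF assms(2)] by blast
  ultimately obtain n :: int where "x = y [^]\<^bsub>prufer_group p\<^esub> n"
    using prufer_group_power_of[OF assms(1), of x y 0] subgroup.subset[OF assms(2)]
    by (auto simp: prufer_subgroup_eq[OF assms(1)])
  then show "x \<in> N"
    using P.subgroup_int_pow_closed[OF assms(2) y(1)] by simp
qed

text \<open>Let \<open>p ^ k\<close> kill some \<open>x\<close> outside \<open>N\<close>. An element
  of \<open>N\<close> not killed by \<open>p ^ k\<close> would have \<open>x\<close> among its
  powers, forcing \<open>x\<close> into \<open>N\<close>.\<close>

lemma prufer_proper_subgroup_exponent: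
  assumes "prime p" "subgroup N (prufer_group p)" "N \<noteq> carrier (prufer_group p)"
  shows "\<exists>k. \<forall>y\<in>N. y [^]\<^bsub>prufer_group p\<^esub> int (p ^ k) = \<one>\<^bsub>prufer_group p\<^esub>"
proof -
  interpret P: comm_group "prufer_group p" by (rule comm_group_prufer_group[OF assms(1)])
  obtain x where x: "x \<in> carrier (prufer_group p)" "x \<notin> N"
    using assms subgroup.subset by blast
  obtain k where k: "x [^]\<^bsub>prufer_group p\<^esub> int (p ^ k) = \<one>\<^bsub>prufer_group p\<^esub>"
    using prufer_group_torsion[OF assms(1) x(1)] by blast
  \<comment> \<open>The comparison of orders takes an exponent \<open>Suc k\<close> for
    \<open>x\<close> against \<open>k\<close> for \<open>y\<close>, so the exponent killing
    \<open>x\<close> is raised by one.\<close>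
  have "int (p ^ Suc k) = int (p ^ k) * int p" by simp
  then have k': "x [^]\<^bsub>prufer_group p\<^esub> int (p ^ Suc k) = \<one>\<^bsub>prufer_group p\<^esub>"
    using k x(1) by (simp only: P.int_pow_pow[symmetric] P.int_pow_one)
  have "y [^]\<^bsub>prufer_group p\<^esub> int (p ^ k) = \<one>\<^bsub>prufer_group p\<^esub>" if y: "y \<in> N" for y
    using prufer_group_power_of[OF assms(1) x(1) _ k', of y] y x(2)
      P.subgroup_int_pow_closed[OF assms(2) y] subgroup.subset[OF assms(2)] by blast
  then show ?thesis by blast
qed

text \<open>For \<open>z\<close> of sufficiently large order, \<open>z [^] n\<close> is not killed
  by \<open>p ^ k\<close> while \<open>y\<close> is. Hence \<open>y\<close> is a power of
  \<open>z [^] n\<close>, and the two exponents can be swapped.\<close>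

lemma prufer_group_divisible:
  assumes "prime p" "(n :: int) \<noteq> 0" "y \<in> carrier (prufer_group p)"
  shows "\<exists>z\<in>carrier (prufer_group p). y = z [^]\<^bsub>prufer_group p\<^esub> n"
proof -
  interpret P: comm_group "prufer_group p" by (rule comm_group_prufer_group[OF assms(1)])
  have p: "p > 1" using prime_gt_1_nat[OF assms(1)] .
  obtain k where k: "y [^]\<^bsub>prufer_group p\<^esub> int (p ^ k) = \<one>\<^bsub>prufer_group p\<^esub>"
    using prufer_group_torsion[OF assms(1,3)] by blast
  have "int (p ^ Suc k) = int (p ^ k) * int p" by simp
  then have k': "y [^]\<^bsub>prufer_group p\<^esub> int (p ^ Suc k) = \<one>\<^bsub>prufer_group p\<^esub>"
    using k assms(3) by (simp only: P.int_pow_pow[symmetric] P.int_pow_one)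
  \<comment> \<open>\<open>nat |n|\<close> is a crude bound for the multiplicity of \<open>p\<close>
    in \<open>n\<close>: since \<open>p ^ nat |n|\<close> exceeds \<open>|n|\<close>, it does not
    divide the nonzero \<open>n\<close>.\<close>
  obtain z where z: "z \<in> carrier (prufer_group p)"
    "\<And>m :: int. z [^]\<^bsub>prufer_group p\<^esub> m = \<one>\<^bsub>prufer_group p\<^esub> \<longleftrightarrow> int (p ^ (nat \<bar>n\<bar> + k)) dvd m"
    using prufer_group_elem_of_order[OF assms(1)] by blast
  have "nat \<bar>n\<bar> < p ^ nat \<bar>n\<bar>" using p by (simp add: power_gt_expt)
  then have "\<bar>n\<bar> < int (p ^ nat \<bar>n\<bar>)" by (simp only: nat_less_iff abs_ge_zero)
  then have "\<not> int (p ^ nat \<bar>n\<bar>) dvd n"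
    using assms(2) zdvd_imp_le[of "int (p ^ nat \<bar>n\<bar>)" "\<bar>n\<bar>"] by auto
  then have "\<not> int (p ^ (nat \<bar>n\<bar> + k)) dvd n * int (p ^ k)"
    using p by (simp add: power_add)
  then have "(z [^]\<^bsub>prufer_group p\<^esub> n) [^]\<^bsub>prufer_group p\<^esub> int (p ^ k) \<noteq> \<one>\<^bsub>prufer_group p\<^esub>"
    using z by (simp only: P.int_pow_pow) simp
  then obtain m :: int where "y = (z [^]\<^bsub>prufer_group p\<^esub> n) [^]\<^bsub>prufer_group p\<^esub> m"
    using prufer_group_power_of[OF assms(1,3) _ k'] z(1) by blast
  then have "y = (z [^]\<^bsub>prufer_group p\<^esub> m) [^]\<^bsub>prufer_group p\<^esub> n"
    using z(1) by (simp add: P.int_pow_pow mult.commute)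
  then show ?thesis using z(1) by blast
qed

text \<open>If \<open>n\<close> were nonzero, divisibility would make every element an
  \<open>n\<close>-th power and hence trivial. This controls the first coordinates in the
  annihilator of \<open>0 \<times> M\<close>.\<close>

lemma prufer_group_faithful:
  assumes "prime p" "\<And>z. z \<in> carrier (prufer_group p) \<Longrightarrow> z [^]\<^bsub>prufer_group p\<^esub> (n :: int) = \<one>\<^bsub>prufer_group p\<^esub>"
  shows "n = 0"
proof (rule ccontr)
  assume "n \<noteq> 0"
  then have "y = \<one>\<^bsub>prufer_group p\<^esub>" if "y \<in> carrier (prufer_group p)" for y
    using prufer_group_divisible[OF assms(1) _ that] assms(2) by metis
  then show False
    using prufer_subgroup_nontrivial[OF assms(1)] subgroup.subset[OF subgroup_prufer_subgroup[OF assms(1)]]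
    by blast
qed

text \<open>One element of order exactly \<open>p\<close> suffices as a test. This controls the
  first coordinates in the annihilator of \<open>0 \<times> C\<close>.\<close>

lemma prufer_subgroup_annihilator:
  assumes "prime p"
    and "\<And>z. z \<in> prufer_subgroup p \<Longrightarrow> z [^]\<^bsub>prufer_group p\<^esub> (n :: int) = \<one>\<^bsub>prufer_group p\<^esub>"
  shows "int p dvd n"
proof -
  obtain z where z: "z \<in> carrier (prufer_group p)"
    "\<And>m :: int. z [^]\<^bsub>prufer_group p\<^esub> m = \<one>\<^bsub>prufer_group p\<^esub> \<longleftrightarrow> int (p ^ 1) dvd m"
    using prufer_group_elem_of_order[OF assms(1)] by blast
  then have "z \<in> prufer_subgroup p" by (simp add: prufer_subgroup_eq[OF assms(1)])
  with assms(2) have "z [^]\<^bsub>prufer_group p\<^esub> n = \<one>\<^bsub>prufer_group p\<^esub>" by blast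
  with z(2)[of n] show ?thesis by simp
qed

text \<open>Induction on the exponent \<open>k\<close> killing \<open>x\<close>: the
  \<open>p\<close>-th power of \<open>x\<close> lies in \<open>N\<close>, so it equals that of some
  \<open>y\<close> in \<open>N\<close>. The quotient of \<open>x\<close> by \<open>y\<close> is then
  \<open>p\<close>-torsion, and \<open>N\<close> contains all \<open>p\<close>-torsion.\<close>

lemma prufer_subgroup_p_divisible:
  assumes "prime p" "subgroup N (prufer_group p)" "N \<noteq> {\<one>\<^bsub>prufer_group p\<^esub>}"
    and div: "N \<subseteq> (\<lambda>x. x [^]\<^bsub>prufer_group p\<^esub> int p) ` N"
  shows "N = carrier (prufer_group p)"
proof
  interpret P: comm_group "prufer_group p" by (rule comm_group_prufer_group[OF assms(1)])
  interpret N: subgroup N "prufer_group p" by fact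
  show "N \<subseteq> carrier (prufer_group p)" by (rule N.subset)
  have "x \<in> N" if "x \<in> carrier (prufer_group p)" "x [^]\<^bsub>prufer_group p\<^esub> int (p ^ k) = \<one>\<^bsub>prufer_group p\<^esub>" for x k
    using that
  proof (induction k arbitrary: x)
    case 0
    then show ?case by simp
  next
    case (Suc k)
    have "(x [^]\<^bsub>prufer_group p\<^esub> int p) [^]\<^bsub>prufer_group p\<^esub> int (p ^ k) = \<one>\<^bsub>prufer_group p\<^esub>"
      using Suc.prems by (simp add: P.int_pow_pow)
    then have "x [^]\<^bsub>prufer_group p\<^esub> int p \<in> N" using Suc by blast
    then obtain y where y: "y \<in> N" "x [^]\<^bsub>prufer_group p\<^esub> int p = y [^]\<^bsub>prufer_group p\<^esub> int p"
      using div by blast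
    let ?d = "x \<otimes>\<^bsub>prufer_group p\<^esub> inv\<^bsub>prufer_group p\<^esub> y"
    have "?d [^]\<^bsub>prufer_group p\<^esub> int p = \<one>\<^bsub>prufer_group p\<^esub>"
      using y Suc.prems by (simp add: P.int_pow_distrib P.int_pow_inv)
    then have "?d \<in> N"
      using prufer_subgroup_least[OF assms(1-3)] Suc.prems y(1)
      by (auto simp: prufer_subgroup_eq[OF assms(1)])
    then have "?d \<otimes>\<^bsub>prufer_group p\<^esub> y \<in> N" using y(1) by blast
    then show ?case using Suc.prems y(1) by (simp add: P.m_assoc)
  qed
  then show "carrier (prufer_group p) \<subseteq> N"
    using prufer_group_torsion[OF assms(1)] by blast
qed

section \<open>Ideals of the trivial extension by the Pruefer group\<close>

lemma ideal_contains_prufer_group: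
  assumes "prime p" "ideal I (idealization (prufer_group p))" "(n, x) \<in> I" "n \<noteq> 0"
  shows "{0} \<times> carrier (prufer_group p) \<subseteq> I"
  using prufer_group_divisible[OF assms(1,4)]
    comm_group.ideal_pow_closed[OF comm_group_prufer_group[OF assms(1)] assms(2,3)] by fastforce

lemma ideal_eq_subgroup:
  assumes "\<And>n x. (n, x) \<in> I \<Longrightarrow> n = 0"
  shows "I = {0} \<times> {x. (0, x) \<in> I}"
  using assms by fastforce

text \<open>An ideal with a nonzero first coordinate contains all of \<open>0 \<times> M\<close>;
  any other ideal is a subgroup of \<open>M\<close>, where leastness is known.\<close>

lemma prufer_subgroup_least_ideal:
  assumes "prime p" "ideal I (idealization (prufer_group p))" "I \<noteq> {(0, \<one>\<^bsub>prufer_group p\<^esub>)}"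
  shows "{0} \<times> prufer_subgroup p \<subseteq> I"
proof (cases "\<exists>n x. (n, x) \<in> I \<and> n \<noteq> 0")
  case True
  then show ?thesis
    using ideal_contains_prufer_group[OF assms(1,2)] subgroup.subset[OF subgroup_prufer_subgroup[OF assms(1)]]
    by blast
next
  case False
  then have I: "I = {0} \<times> {x. (0, x) \<in> I}" by (intro ideal_eq_subgroup) blast
  then have "{x. (0, x) \<in> I} \<noteq> {\<one>\<^bsub>prufer_group p\<^esub>}" using assms(3) by auto
  then have "prufer_subgroup p \<subseteq> {x. (0, x) \<in> I}"
    by (rule prufer_subgroup_least[OF assms(1)
          comm_group.subgroup_of_ideal[OF comm_group_prufer_group[OF assms(1)] assms(2)]])
  then show ?thesis by blast
qed

section \<open>Coprimality of the two ideals\<close>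

lemma ideal_coproduct_zero_left:
  assumes "cring A"
  shows "ideal_coproduct A {\<zero>\<^bsub>A\<^esub>} J \<subseteq> J"
proof -
  interpret cring A by fact
  have "\<one>\<^bsub>A\<^esub> \<in> annihilator A {\<zero>\<^bsub>A\<^esub>}" by (simp add: annihilator_def)
  then show ?thesis
    unfolding ideal_coproduct_def ideal_residual_def using r_one by fastforce
qed

text \<open>For nonzero \<open>I\<close> leastness gives \<open>C \<subseteq> I\<close>. For zero
  \<open>I\<close> the coproduct lies in \<open>J\<close>, because the identity annihilates
  \<open>I\<close>.\<close>

lemma coprime_ideal_if_least:
  assumes "cring A" "ideal C A" "C \<noteq> {\<zero>\<^bsub>A\<^esub>}"
    and "\<And>I. ideal I A \<Longrightarrow> I \<noteq> {\<zero>\<^bsub>A\<^esub>} \<Longrightarrow> C \<subseteq> I"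
  shows "coprime_ideal C A"
  using assms ideal_coproduct_zero_left[OF assms(1)] unfolding coprime_ideal_def by blast

lemma coprime_ideal_prufer_subgroup:
  assumes "prime p"
  shows "coprime_ideal ({0} \<times> prufer_subgroup p) (idealization (prufer_group p))"
proof -
  interpret P: comm_group "prufer_group p" by (rule comm_group_prufer_group[OF assms])
  show ?thesis
    using prufer_subgroup_nontrivial[OF assms] prufer_subgroup_least_ideal[OF assms]
    by (intro coprime_ideal_if_least P.cring_idealization P.ideal_of_subgroup
        subgroup_prufer_subgroup assms) (auto simp: idealization_simps)
qed

lemma coprime_ideal_prufer_group:
  assumes "prime p"
  shows "coprime_ideal ({0} \<times> carrier (prufer_group p)) (idealization (prufer_group p))"
    (is "coprime_ideal ?M ?A")
proof -
  interpret P: comm_group "prufer_group p" by (rule comm_group_prufer_group[OF assms])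
  have "?M \<noteq> {\<zero>\<^bsub>?A\<^esub>}"
    using prufer_subgroup_nontrivial[OF assms] subgroup.subset[OF subgroup_prufer_subgroup[OF assms]]
    by (auto simp: idealization_simps)
  moreover have "?M \<subseteq> J"
    if I: "ideal I ?A" and IJ: "?M \<subseteq> ideal_coproduct ?A I J" and nI: "\<not> ?M \<subseteq> I" for I J
  proof -
    let ?N = "{x. (0, x) \<in> I}"
    \<comment> \<open>A nonzero first coordinate would force all of \<open>0 \<times> M\<close> into
      \<open>I\<close>.\<close>
    have n0: "n = 0" if "(n, x) \<in> I" for n x
      using ideal_contains_prufer_group[OF assms I that] nI by blast
    obtain k where k: "\<forall>y\<in>?N. y [^]\<^bsub>prufer_group p\<^esub> int (p ^ k) = \<one>\<^bsub>prufer_group p\<^esub>"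
      using prufer_proper_subgroup_exponent[OF assms P.subgroup_of_ideal[OF I]] nI by blast
    \<comment> \<open>On elements with first coordinate 0, \<open>?a\<close> acts as the
      \<open>p ^ k\<close>-th power: it kills \<open>I\<close> but maps \<open>0 \<times> M\<close>
      onto itself.\<close>
    let ?a = "(int (p ^ k), \<one>\<^bsub>prufer_group p\<^esub>)"
    have "?a \<otimes>\<^bsub>?A\<^esub> c = \<zero>\<^bsub>?A\<^esub>" if "c \<in> I" for c
    proof (cases c)
      case (Pair n x)
      with that have "n = 0" "x \<in> ?N" using n0 by auto
      with k Pair show ?thesis by (simp add: idealization_simps)
    qed
    then have ann: "?a \<in> annihilator ?A I"
      by (simp add: annihilator_def idealization_simps)
    show "?M \<subseteq> J"
    proof clarsimp
      fix y assume y: "y \<in> carrier (prufer_group p)"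
      have "int (p ^ k) \<noteq> 0" using assms prime_gt_0_nat by auto
      then obtain z where z: "z \<in> carrier (prufer_group p)" "y = z [^]\<^bsub>prufer_group p\<^esub> int (p ^ k)"
        using prufer_group_divisible[OF assms _ y] by blast
      \<comment> \<open>This product is \<open>(0, y)\<close>, so the coproduct hypothesis applied
        to \<open>(0, z)\<close> brings \<open>y\<close> into \<open>J\<close>.\<close>
      have "(0, z) \<otimes>\<^bsub>?A\<^esub> ?a \<in> J"
        using IJ ann z(1) by (auto simp: ideal_coproduct_def ideal_residual_def)
      then show "(0, y) \<in> J" using z y by (simp add: idealization_simps)
    qed
  qed
  ultimately show ?thesis
    unfolding coprime_ideal_def using P.ideal_of_subgroup[OF P.subgroup_self] by blast
qed

section \<open>Exclusion of all other coprime ideals\<close>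

lemma coprime_ideal_subset_prufer_group:
  assumes "prime p" "coprime_ideal C (idealization (prufer_group p))"
  shows "C \<subseteq> {0} \<times> carrier (prufer_group p)"
proof -
  interpret P: comm_group "prufer_group p" by (rule comm_group_prufer_group[OF assms(1)])
  let ?A = "idealization (prufer_group p)" and ?M = "{0} \<times> carrier (prufer_group p)"
  have C: "ideal C ?A" using assms(2) by (simp add: coprime_ideal_def)
  have M: "ideal ?M ?A" by (rule P.ideal_of_subgroup[OF P.subgroup_self])
  have "fst a = 0" if a: "a \<in> annihilator ?A ?M" for a
  proof (rule prufer_group_faithful[OF assms(1)])
    fix z assume z: "z \<in> carrier (prufer_group p)"
    show "z [^]\<^bsub>prufer_group p\<^esub> fst a = \<one>\<^bsub>prufer_group p\<^esub>"
      using a z by (cases a) (auto simp: annihilator_def idealization_simps)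
  qed
  moreover have "annihilator ?A ?M \<subseteq> UNIV \<times> carrier (prufer_group p)"
    by (auto simp: annihilator_def idealization_simps)
  ultimately have "annihilator ?A ?M \<subseteq> ?M" by force
  \<comment> \<open>As \<open>?M\<close> absorbs multiplication and contains its own annihilator,
    its coproduct with itself is the whole ring, so any ideal passes this premise.\<close>
  then have "C \<subseteq> ideal_coproduct ?A ?M ?M"
    using ideal.I_l_closed[OF M] ideal.Icarr[OF C]
    unfolding ideal_coproduct_def ideal_residual_def by blast
  then show ?thesis using assms(2) M unfolding coprime_ideal_def by blast
qed

text \<open>An element annihilating \<open>0 \<times> C\<close> has first coordinate divisible by
  \<open>p\<close>, so it multiplies \<open>0 \<times> N\<close> into \<open>0 \<times> pN\<close>.
  Coprimality then leaves two cases, settled by leastness of \<open>C\<close> and by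
  \<open>p\<close>-divisibility of \<open>N\<close>.\<close>

lemma coprime_ideal_subgroup_cases:
  assumes "prime p" "subgroup N (prufer_group p)"
    and coprime: "coprime_ideal ({0} \<times> N) (idealization (prufer_group p))"
  shows "N = prufer_subgroup p \<or> N = carrier (prufer_group p)"
proof -
  interpret P: comm_group "prufer_group p" by (rule comm_group_prufer_group[OF assms(1)])
  interpret N: subgroup N "prufer_group p" by fact
  let ?A = "idealization (prufer_group p)"
  let ?I = "{0 :: int} \<times> prufer_subgroup p"
  let ?pN = "(\<lambda>x. x [^]\<^bsub>prufer_group p\<^esub> int p) ` N"
  have N1: "N \<noteq> {\<one>\<^bsub>prufer_group p\<^esub>}"
    using coprime by (auto simp: coprime_ideal_def idealization_simps)
  have I: "ideal ?I ?A"
    by (rule P.ideal_of_subgroup[OF subgroup_prufer_subgroup[OF assms(1)]])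
  have J: "ideal ({0} \<times> ?pN) ?A"
    by (rule P.ideal_of_subgroup[OF P.subgroup_image_int_pow[OF assms(2)]])
  have "{0} \<times> N \<subseteq> ideal_coproduct ?A ?I ({0} \<times> ?pN)"
    unfolding ideal_coproduct_def ideal_residual_def
  proof (clarsimp simp: idealization_simps)
    fix x m y assume x: "x \<in> N" and a: "(m, y) \<in> annihilator ?A ?I"
    have y: "y \<in> carrier (prufer_group p)"
      using a by (simp add: annihilator_def idealization_simps)
    have "int p dvd m"
    proof (rule prufer_subgroup_annihilator[OF assms(1)])
      fix z assume z: "z \<in> prufer_subgroup p"
      then have "z \<in> carrier (prufer_group p)"
        using subgroup.subset[OF subgroup_prufer_subgroup[OF assms(1)]] by blast
      then show "z [^]\<^bsub>prufer_group p\<^esub> m = \<one>\<^bsub>prufer_group p\<^esub>"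
        using a z y by (auto simp: annihilator_def idealization_simps)
    qed
    then obtain c where "m = c * int p" by (metis dvdE mult.commute)
    \<comment> \<open>The factor \<open>p\<close> is placed outermost, so that the base
      \<open>x [^] c\<close> lies in \<open>N\<close> and the power lies in
      \<open>?pN\<close>.\<close>
    then have "x [^]\<^bsub>prufer_group p\<^esub> m = (x [^]\<^bsub>prufer_group p\<^esub> c) [^]\<^bsub>prufer_group p\<^esub> int p"
      using x by (simp add: P.int_pow_pow)
    then show "x [^]\<^bsub>prufer_group p\<^esub> m \<in> ?pN"
      using P.subgroup_int_pow_closed[OF assms(2) x] by blast
  qed
  then have "{0} \<times> N \<subseteq> ?I \<or> {0} \<times> N \<subseteq> {0 :: int} \<times> ?pN"
    using coprime I J unfolding coprime_ideal_def by blast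
  then have "N \<subseteq> prufer_subgroup p \<or> N \<subseteq> ?pN" by auto
  then show ?thesis
    using prufer_subgroup_least[OF assms(1,2) N1] prufer_subgroup_p_divisible[OF assms(1,2) N1] by blast
qed

theorem proposition14:
  fixes p :: nat
  assumes "prime p"
  shows "CoSp (trivial_extension \<Z> (int_module (prufer_group p))) =
    {{0} \<times> prufer_subgroup p, {0} \<times> carrier (prufer_group p)}"
proof -
  interpret P: comm_group "prufer_group p" by (rule comm_group_prufer_group[OF assms])
  have "C = {0} \<times> prufer_subgroup p \<or> C = {0} \<times> carrier (prufer_group p)"
    if C: "coprime_ideal C (idealization (prufer_group p))" for C
  proof -
    let ?N = "{x. (0, x) \<in> C}"
    \<comment> \<open>Containment in \<open>0 \<times> M\<close> makes all first coordinates vanish,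
      so \<open>C\<close> is determined by its second coordinates.\<close>
    have eq: "C = {0} \<times> ?N"
      using coprime_ideal_subset_prufer_group[OF assms C] by (intro ideal_eq_subgroup) blast
    have "subgroup ?N (prufer_group p)"
      using C by (intro P.subgroup_of_ideal) (simp add: coprime_ideal_def)
    then have "?N = prufer_subgroup p \<or> ?N = carrier (prufer_group p)"
      using coprime_ideal_subgroup_cases[OF assms] C eq by metis
    then show ?thesis using eq by metis
  qed
  then show ?thesis
    using coprime_ideal_prufer_subgroup[OF assms] coprime_ideal_prufer_group[OF assms]
    unfolding CoSp_def by blast
qed

end
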